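(* Let $(\mathbf x^*,\mathbf y^* )$ be an optimal solution of the linear program (RAOC-LP), with products labeled so that $x_1^*\ge x_2^*\ge\dots\ge x_n^*$. Put $x_{n+1}^*=0$ and $S_p=\{1,\dots,p\}$ for $p\in\{1,\dots,n\}$, and define $$q^*(S)=\begin{cases}\left(1+\sum_{j=1}^p v_j\right)(x_p^*-x_{p+1}^* ), & \text{if } S=S_p \text{ for some } p\in\{1,\dots,n\},\\ 1-\sum_{p=1}^n q^*(S_p), & \text{if } S=\varnothing,\\ 0,&\text{otherwise.}\end{cases}$$ Then $q^*(\cdot)$ is an optimal solution of (RAOC).
   Context: Products $\mathcal N=\{1,\dots,n\}$ have revenues $r_i\in\mathbb R$ and preference weights $v_i>0$; there are categories $C_1,\dots,C_K\subseteq\mathcal N$ (possibly overlapping) with integer thresholds $0\le\ell_k\le|C_k|$. For $S\subseteq\mathcal N$ let $R(S)=\dfrac{\sum_{i\in S}r_iv_i}{1+\sum_{i\in S}v_i}$. (RAOC) is the problem of maximizing $\sum_{S\subseteq\mathcal N}R(S)q(S)$ over functions $q:2^{\mathcal N}\to\mathbb R$ subject to $\sum_{S\subseteq\mathcal N}|S\cap C_k|q(S)\ge\ell_k$ for all $k\in\{1,\dots,K\}$, $\sum_{S\subseteq\mathcal N}q(S)=1$, and $q(S)\ge0$ for all $S\subseteq\mathcal N$. (RAOC-LP) is the linear program in variables $x_0$, $(x_i)_{i\in\mathcal N}$, $(y_{ij})_{i,j\in\mathcal N}$: maximize $\sum_{i\in\mathcal N}r_iv_ix_i$ subject to - $x_0+\sum_{i\in\mathcal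 N}v_ix_i=1$; - $x_i\le x_0$ for all $i\in\mathcal N$; - $y_{ij}\le x_i$ and $y_{ij}\le x_j$ for all $i,j\in\mathcal N$; - $\sum_{i\in C_k}\left(x_i+\sum_{j\in\mathcal N}v_jy_{ij}\right)\ge\ell_k$ for all $k\in\{1,\dots,K\}$; - $x_i\ge0$ and $y_{ij}\ge0$ for all $i,j\in\mathcal N$. *)

theory Defs
  imports "HOL-Analysis.Analysis"
begin

definition revenue :: "(nat \<Rightarrow> real) \<Rightarrow> (nat \<Rightarrow> real) \<Rightarrow> nat set \<Rightarrow> real" where
  "revenue r v S = (\<Sum>i\<in>S. r i * v i) / (1 + (\<Sum>i\<in>S. v i))"

(* A function on the subsets of {1..n} is a total function on nat set of which
   only the values on Pow {1..n} are ever inspected. *)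

definition raoc_objective ::
  "nat \<Rightarrow> (nat \<Rightarrow> real) \<Rightarrow> (nat \<Rightarrow> real) \<Rightarrow> (nat set \<Rightarrow> real) \<Rightarrow> real" where
  "raoc_objective n r v q = (\<Sum>S\<in>Pow {1..n}. revenue r v S * q S)"

definition raoc_feasible ::
  "nat \<Rightarrow> nat \<Rightarrow> (nat \<Rightarrow> nat set) \<Rightarrow> (nat \<Rightarrow> int) \<Rightarrow> (nat set \<Rightarrow> real) \<Rightarrow> bool" where
  "raoc_feasible n K C l q \<longleftrightarrow>
     (\<forall>k\<in>{1..K}. (\<Sum>S\<in>Pow {1..n}. real (card (S \<inter> C k)) * q S) \<ge> real_of_int (l k)) \<and>
     (\<Sum>S\<in>Pow {1..n}. q S) = 1 \<and>
     (\<forall>S\<in>Pow {1..n}. q S \<ge> 0)"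

definition raoc_optimal ::
  "nat \<Rightarrow> (nat \<Rightarrow> real) \<Rightarrow> (nat \<Rightarrow> real) \<Rightarrow> nat \<Rightarrow> (nat \<Rightarrow> nat set) \<Rightarrow> (nat \<Rightarrow> int)
     \<Rightarrow> (nat set \<Rightarrow> real) \<Rightarrow> bool" where
  "raoc_optimal n r v K C l q \<longleftrightarrow>
     is_arg_max (raoc_objective n r v) (raoc_feasible n K C l) q"

(* The variable x_0 of the linear program is x 0; entries of x above n and of y
   outside {1..n} x {1..n} are irrelevant. *)

definition lp_objective ::
  "nat \<Rightarrow> (nat \<Rightarrow> real) \<Rightarrow> (nat \<Rightarrow> real) \<Rightarrow> (nat \<Rightarrow> real) \<times> (nat \<Rightarrow> nat \<Rightarrow> real) \<Rightarrow> real" where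
  "lp_objective n r v = (\<lambda>(x, y). \<Sum>i=1..n. r i * v i * x i)"

definition lp_feasible ::
  "nat \<Rightarrow> (nat \<Rightarrow> real) \<Rightarrow> nat \<Rightarrow> (nat \<Rightarrow> nat set) \<Rightarrow> (nat \<Rightarrow> int)
     \<Rightarrow> (nat \<Rightarrow> real) \<times> (nat \<Rightarrow> nat \<Rightarrow> real) \<Rightarrow> bool" where
  "lp_feasible n v K C l = (\<lambda>(x, y).
     x 0 + (\<Sum>i=1..n. v i * x i) = 1 \<and>
     (\<forall>i\<in>{1..n}. x i \<le> x 0) \<and>
     (\<forall>i\<in>{1..n}. \<forall>j\<in>{1..n}. y i j \<le> x i \<and> y i j \<le> x j) \<and>
     (\<forall>k\<in>{1..K}. (\<Sum>i\<in>C k. x i + (\<Sum>j=1..n. v j * y i j)) \<ge> real_of_int (l k)) \<and>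
     (\<forall>i\<in>{1..n}. x i \<ge> 0) \<and>
     (\<forall>i\<in>{1..n}. \<forall>j\<in>{1..n}. y i j \<ge> 0))"

definition lp_optimal ::
  "nat \<Rightarrow> (nat \<Rightarrow> real) \<Rightarrow> (nat \<Rightarrow> real) \<Rightarrow> nat \<Rightarrow> (nat \<Rightarrow> nat set) \<Rightarrow> (nat \<Rightarrow> int)
     \<Rightarrow> (nat \<Rightarrow> real) \<times> (nat \<Rightarrow> nat \<Rightarrow> real) \<Rightarrow> bool" where
  "lp_optimal n r v K C l xy \<longleftrightarrow>
     is_arg_max (lp_objective n r v) (lp_feasible n v K C l) xy"

(* The update at n + 1 is the convention x_{n+1} = 0. *)
definition nested_weight :: "nat \<Rightarrow> (nat \<Rightarrow> real) \<Rightarrow> (nat \<Rightarrow> real) \<Rightarrow> nat \<Rightarrow> real" where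
  "nested_weight n v x p =
     (1 + (\<Sum>j=1..p. v j)) * ((x(n + 1 := 0)) p - (x(n + 1 := 0)) (p + 1))"

(* The set {1..p} determines p when p \<ge> 1, so the description is unique; {} is not of
   this form for any p in {1..n}. *)
definition q_star :: "nat \<Rightarrow> (nat \<Rightarrow> real) \<Rightarrow> (nat \<Rightarrow> real) \<Rightarrow> nat set \<Rightarrow> real" where
  "q_star n v x S =
     (if \<exists>p\<in>{1..n}. S = {1..p} then nested_weight n v x (THE p. p \<in> {1..n} \<and> S = {1..p})
      else if S = {} then 1 - (\<Sum>p=1..n. nested_weight n v x p)
      else 0)"

end

theory Submission
  imports Defs
begin

text \<open>
  Rescaling by the preference weights turns (RAOC) into a statement about marginals. Let
  \<open>W S\<close> be one plus the sum of the weights in \<open>S\<close>, put \<open>u S = q S / W S\<close>, and let the marginal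
  of a set \<open>T\<close> of products be the sum of \<open>u S\<close> over all \<open>S \<supseteq> T\<close>. (In the multinomial logit
  model \<open>u S\<close> is the probability that \<open>S\<close> is offered and nothing is bought, so that \<open>v\<^sub>i\<close> times
  the marginal of \<open>{i}\<close> is the probability that \<open>i\<close> is sold.) The revenue has the denominator
  \<open>W S\<close>, so the objective is linear in the marginals of singletons. Writing \<open>q S = W S * u S\<close>
  and expanding \<open>W S\<close> makes the total mass a combination of marginals of at most one product,
  and the category sums a combination of marginals of one and two products (lemmas
  \<open>objective_eq_marginals\<close>, \<open>mass_eq_marginals\<close>, \<open>category_sum_eq_marginals\<close>). These are exactly
  the expressions in (RAOC-LP), with the marginals of \<open>{}\<close>, \<open>{i}\<close> and \<open>{i, j}\<close> in the places of
  \<open>x\<^sub>0\<close>, \<open>x\<^sub>i\<close> and \<open>y\<^sub>i\<^sub>j\<close>. Marginals of a nonnegative function decrease as \<open>T\<close> grows, which gives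
  the remaining constraints. So every feasible \<open>q\<close> yields a feasible point of the linear program
  with the same objective value: (RAOC-LP) is a relaxation of (RAOC).

  The function \<open>q\<^sup>*\<close> shows that the relaxation is tight. On the nested sets \<open>{1..p}\<close> its
  rescaling is the decrement of \<open>x\<close> at \<open>p\<close>, so the marginal of a nonempty \<open>T\<close> telescopes to
  the value of \<open>x\<close> at the largest element of \<open>T\<close> (lemma \<open>marginal_q_star\<close>). Since \<open>x\<close> is
  decreasing, this is the smallest value of \<open>x\<close> on \<open>T\<close>. Thus \<open>q\<^sup>*\<close> has marginals \<open>x\<^sub>i\<close> for
  singletons and \<open>min x\<^sub>i x\<^sub>j\<close> for pairs. The latter is the largest value that the linear program
  allows for \<open>y\<^sub>i\<^sub>j\<close>, so the category sums of \<open>q\<^sup>*\<close> are at least those of the given optimal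
  solution, while the objective is the same.
\<close>

section \<open>Rescaled marginals\<close>

definition total_weight :: "(nat \<Rightarrow> real) \<Rightarrow> nat set \<Rightarrow> real" where
  "total_weight v S = 1 + (\<Sum>i\<in>S. v i)"

definition marginal ::
  "nat \<Rightarrow> (nat \<Rightarrow> real) \<Rightarrow> (nat set \<Rightarrow> real) \<Rightarrow> nat set \<Rightarrow> real" where
  "marginal n v q T = (\<Sum>S\<in>Pow {1..n}. of_bool (T \<subseteq> S) * (q S / total_weight v S))"

lemma total_weight_pos:
  assumes "\<forall>i\<in>{1..n}. v i > 0" and "S \<subseteq> {1..n}"
  shows "total_weight v S > 0"
proof -
  have "(\<Sum>i\<in>S. v i) \<ge> 0"
    using assms by (intro sum_nonneg) (auto simp: less_imp_le subset_iff)
  then show ?thesis by (simp add: total_weight_def)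
qed

lemma marginal_nonneg:
  assumes "\<forall>i\<in>{1..n}. v i > 0" and "\<And>S. S \<subseteq> {1..n} \<Longrightarrow> q S \<ge> 0"
  shows "marginal n v q T \<ge> 0"
  unfolding marginal_def
proof (rule sum_nonneg)
  fix S assume "S \<in> Pow {1..n}"
  then have S: "S \<subseteq> {1..n}" by simp
  show "of_bool (T \<subseteq> S) * (q S / total_weight v S) \<ge> 0"
    using total_weight_pos[OF assms(1) S] assms(2)[OF S] by simp
qed

lemma marginal_antimono:
  assumes "\<forall>i\<in>{1..n}. v i > 0" and "\<And>S. S \<subseteq> {1..n} \<Longrightarrow> q S \<ge> 0" and "T \<subseteq> T'"
  shows "marginal n v q T' \<le> marginal n v q T"
  unfolding marginal_def
proof (rule sum_mono)
  fix S assume "S \<in> Pow {1..n}"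
  then have S: "S \<subseteq> {1..n}" by simp
  show "of_bool (T' \<subseteq> S) * (q S / total_weight v S)
      \<le> of_bool (T \<subseteq> S) * (q S / total_weight v S)"
    using total_weight_pos[OF assms(1) S] assms(2)[OF S] assms(3)
    by (intro mult_right_mono) auto
qed

text \<open>
  The exchange of summation behind all three identities between (RAOC) and (RAOC-LP): the
  coefficient of \<open>q S / total_weight v S\<close> on the left collects \<open>a t\<close> over those \<open>t\<close> for which \<open>T t\<close> is contained
  in \<open>S\<close>.
\<close>

lemma sum_marginals:
  "(\<Sum>S\<in>Pow {1..n}. (\<Sum>t\<in>I. a t * of_bool (T t \<subseteq> S)) * (q S / total_weight v S))
     = (\<Sum>t\<in>I. a t * marginal n v q (T t))"
proof -
  have "(\<Sum>S\<in>Pow {1..n}. (\<Sum>t\<in>I. a t * of_bool (T t \<subseteq> S)) * (q S / total_weight v S))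
      = (\<Sum>S\<in>Pow {1..n}. \<Sum>t\<in>I. a t * (of_bool (T t \<subseteq> S) * (q S / total_weight v S)))"
    by (simp only: sum_distrib_right mult.assoc)
  also have "\<dots> = (\<Sum>t\<in>I. a t * marginal n v q (T t))"
    unfolding marginal_def by (subst sum.swap) (simp only: sum_distrib_left)
  finally show ?thesis .
qed

lemma sum_of_bool_singleton:
  fixes a :: "nat \<Rightarrow> real"
  assumes "finite I" and "S \<subseteq> I"
  shows "(\<Sum>i\<in>I. a i * of_bool ({i} \<subseteq> S)) = (\<Sum>i\<in>S. a i)"
  using assms by (intro sum.mono_neutral_cong_right) auto

lemma objective_eq_marginals:
  "raoc_objective n r v q = (\<Sum>i=1..n. r i * v i * marginal n v q {i})"
proof -
  have "raoc_objective n r v q =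
      (\<Sum>S\<in>Pow {1..n}. (\<Sum>i=1..n. (r i * v i) * of_bool ({i} \<subseteq> S)) * (q S / total_weight v S))"
    unfolding raoc_objective_def
  proof (rule sum.cong[OF refl])
    fix S assume "S \<in> Pow {1..n}"
    then have S: "S \<subseteq> {1..n}" by simp
    show "revenue r v S * q S =
        (\<Sum>i=1..n. (r i * v i) * of_bool ({i} \<subseteq> S)) * (q S / total_weight v S)"
      unfolding sum_of_bool_singleton[OF finite_atLeastAtMost S]
      by (simp add: revenue_def total_weight_def)
  qed
  also have "\<dots> = (\<Sum>i=1..n. r i * v i * marginal n v q {i})"
    by (rule sum_marginals)
  finally show ?thesis .
qed

lemma mass_eq_marginals:
  assumes "\<forall>i\<in>{1..n}. v i > 0"
  shows "(\<Sum>S\<in>Pow {1..n}. q S) = marginal n v q {} + (\<Sum>i=1..n. v i * marginal n v q {i})"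
proof -
  have "(\<Sum>S\<in>Pow {1..n}. q S) =
      (\<Sum>S\<in>Pow {1..n}. of_bool ({} \<subseteq> S) * (q S / total_weight v S)
         + (\<Sum>i=1..n. v i * of_bool ({i} \<subseteq> S)) * (q S / total_weight v S))"
  proof (rule sum.cong[OF refl])
    fix S assume "S \<in> Pow {1..n}"
    then have S: "S \<subseteq> {1..n}" by simp
    have "q S = total_weight v S * (q S / total_weight v S)"
      using total_weight_pos[OF assms S] by simp
    also have "\<dots> = of_bool ({} \<subseteq> S) * (q S / total_weight v S)
         + (\<Sum>i=1..n. v i * of_bool ({i} \<subseteq> S)) * (q S / total_weight v S)"
      unfolding sum_of_bool_singleton[OF finite_atLeastAtMost S]
      by (subst (1) total_weight_def) (simp only: distrib_right, simp)
    finally show "q S = of_bool ({} \<subseteq> S) * (q S / total_weight v S)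
         + (\<Sum>i=1..n. v i * of_bool ({i} \<subseteq> S)) * (q S / total_weight v S)" .
  qed
  also have "\<dots> = marginal n v q {} + (\<Sum>i=1..n. v i * marginal n v q {i})"
    unfolding sum.distrib sum_marginals by (simp only: marginal_def)
  finally show ?thesis .
qed

text \<open>
  Two-element marginals appear because \<open>card (S \<inter> A)\<close> meets the sum in \<open>W S\<close>: their product
  runs over the pairs \<open>(i, j)\<close> with \<open>i \<in> A\<close> and \<open>{i, j} \<subseteq> S\<close>. The pair \<open>(i, i)\<close> contributes the
  marginal of \<open>{i, i} = {i}\<close>, in accordance with the diagonal variables of the linear program.
\<close>

lemma category_sum_eq_marginals:
  assumes v: "\<forall>i\<in>{1..n}. v i > 0" and A: "A \<subseteq> {1..n}"
  shows "(\<Sum>S\<in>Pow {1..n}. real (card (S \<inter> A)) * q S)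
     = (\<Sum>i\<in>A. marginal n v q {i} + (\<Sum>j=1..n. v j * marginal n v q {i, j}))"
proof -
  have finA: "finite A" using A by (rule finite_subset) simp
  have "(\<Sum>S\<in>Pow {1..n}. real (card (S \<inter> A)) * q S) =
      (\<Sum>S\<in>Pow {1..n}. (\<Sum>i\<in>A. 1 * of_bool ({i} \<subseteq> S)) * (q S / total_weight v S)
         + (\<Sum>(i, j)\<in>A \<times> {1..n}. v j * of_bool ({i, j} \<subseteq> S)) * (q S / total_weight v S))"
  proof (rule sum.cong[OF refl])
    fix S assume "S \<in> Pow {1..n}"
    then have S: "S \<subseteq> {1..n}" by simp
    have card: "(\<Sum>i\<in>A. 1 * of_bool ({i} \<subseteq> S)) = real (card (S \<inter> A))"
      using finA by (simp add: Int_commute flip: of_bool_def sum.inter_filter)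
    have "(\<Sum>(i, j)\<in>A \<times> {1..n}. v j * of_bool ({i, j} \<subseteq> S))
        = (\<Sum>i\<in>A. \<Sum>j=1..n. (1 * of_bool ({i} \<subseteq> S)) * (v j * of_bool ({j} \<subseteq> S)))"
      unfolding sum.cartesian_product[symmetric]
      by (intro sum.cong refl) auto
    also have "\<dots> = (\<Sum>i\<in>A. 1 * of_bool ({i} \<subseteq> S)) * (\<Sum>j=1..n. v j * of_bool ({j} \<subseteq> S))"
      by (rule sum_product[symmetric])
    also have "\<dots> = real (card (S \<inter> A)) * (\<Sum>j\<in>S. v j)"
      unfolding card sum_of_bool_singleton[OF finite_atLeastAtMost S] ..
    finally have pairs: "(\<Sum>(i, j)\<in>A \<times> {1..n}. v j * of_bool ({i, j} \<subseteq> S))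
        = real (card (S \<inter> A)) * (\<Sum>j\<in>S. v j)" .
    have "real (card (S \<inter> A)) * q S
        = (real (card (S \<inter> A)) * total_weight v S) * (q S / total_weight v S)"
      using total_weight_pos[OF v S] by simp
    also have "real (card (S \<inter> A)) * total_weight v S
        = real (card (S \<inter> A)) + real (card (S \<inter> A)) * (\<Sum>j\<in>S. v j)"
      by (simp add: total_weight_def distrib_left)
    finally show "real (card (S \<inter> A)) * q S =
        (\<Sum>i\<in>A. 1 * of_bool ({i} \<subseteq> S)) * (q S / total_weight v S)
         + (\<Sum>(i, j)\<in>A \<times> {1..n}. v j * of_bool ({i, j} \<subseteq> S)) * (q S / total_weight v S)"
      unfolding card pairs by (simp only: distrib_right)
  qed
  also have "\<dots> = (\<Sum>i\<in>A. 1 * marginal n v q {i})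
      + (\<Sum>(i, j)\<in>A \<times> {1..n}. v j * marginal n v q {i, j})"
    unfolding sum.distrib sum_marginals
    using sum_marginals[where n = n and I = "A \<times> {1..n}" and a = "\<lambda>(i, j). v j"
      and T = "\<lambda>(i, j). {i, j}" and q = q and v = v]
    by (simp add: case_prod_unfold)
  also have "\<dots> = (\<Sum>i\<in>A. marginal n v q {i} + (\<Sum>j=1..n. v j * marginal n v q {i, j}))"
    by (simp add: sum.distrib sum.cartesian_product)
  finally show ?thesis .
qed

section \<open>The linear program as a relaxation\<close>

definition marginal_point ::
  "nat \<Rightarrow> (nat \<Rightarrow> real) \<Rightarrow> (nat set \<Rightarrow> real) \<Rightarrow> (nat \<Rightarrow> real) \<times> (nat \<Rightarrow> nat \<Rightarrow> real)" where
  "marginal_point n v q =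
     (\<lambda>i. marginal n v q (if i = 0 then {} else {i}), \<lambda>i j. marginal n v q {i, j})"

lemma lp_objective_marginal_point:
  "lp_objective n r v (marginal_point n v q) = raoc_objective n r v q"
  by (simp add: lp_objective_def marginal_point_def objective_eq_marginals)

lemma lp_feasible_marginal_point:
  assumes v: "\<forall>i\<in>{1..n}. v i > 0"
    and C: "\<And>k. k \<in> {1..K} \<Longrightarrow> C k \<subseteq> {1..n}"
    and feas: "raoc_feasible n K C l q"
  shows "lp_feasible n v K C l (marginal_point n v q)"
proof -
  have q: "q S \<ge> 0" if "S \<subseteq> {1..n}" for S
    using feas that by (simp add: raoc_feasible_def)
  have mass: "marginal n v q {} + (\<Sum>i=1..n. v i * marginal n v q {i}) = 1"
    using feas mass_eq_marginals[OF v, of q]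
    by (simp add: raoc_feasible_def)
  have cat: "(\<Sum>i\<in>C k. marginal n v q (if i = 0 then {} else {i})
      + (\<Sum>j=1..n. v j * marginal n v q {i, j})) \<ge> real_of_int (l k)" if k: "k \<in> {1..K}" for k
  proof -
    have "real_of_int (l k) \<le> (\<Sum>S\<in>Pow {1..n}. real (card (S \<inter> C k)) * q S)"
      using feas k by (simp add: raoc_feasible_def)
    also have "\<dots> = (\<Sum>i\<in>C k. marginal n v q {i} + (\<Sum>j=1..n. v j * marginal n v q {i, j}))"
      by (rule category_sum_eq_marginals[OF v C[OF k]])
    also have "\<dots> = (\<Sum>i\<in>C k. marginal n v q (if i = 0 then {} else {i})
        + (\<Sum>j=1..n. v j * marginal n v q {i, j}))"
      using C[OF k] by (intro sum.cong refl) auto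
    finally show ?thesis .
  qed
  have anti: "marginal n v q T' \<le> marginal n v q T" if "T \<subseteq> T'" for T T'
    using marginal_antimono[OF v q that] .
  have nonneg: "marginal n v q T \<ge> 0" for T
    using marginal_nonneg[OF v q] .
  show ?thesis
    using mass cat by (auto simp: lp_feasible_def marginal_point_def nonneg intro!: anti)
qed

section \<open>Marginals of the nested solution\<close>

lemma q_star_empty: "q_star n v x {} = 1 - (\<Sum>p=1..n. nested_weight n v x p)"
  by (auto simp: q_star_def)

lemma q_star_initial_segment:
  assumes "p \<in> {1..n}"
  shows "q_star n v x {1..p} = nested_weight n v x p"
proof -
  have "(THE p'. p' \<in> {1..n} \<and> {1..p} = {1..p'}) = p"
    using assms by (intro the_equality) auto
  then show ?thesis using assms by (auto simp: q_star_def)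
qed

lemma sum_q_star:
  "(\<Sum>S\<in>Pow {1..n}. f S * q_star n v x S)
     = f {} * q_star n v x {} + (\<Sum>p=1..n. f {1..p} * nested_weight n v x p)"
proof -
  let ?I = "(\<lambda>p. {1..p}) ` {1..n}"
  have "(\<Sum>S\<in>Pow {1..n}. f S * q_star n v x S) = (\<Sum>S\<in>insert {} ?I. f S * q_star n v x S)"
    by (intro sum.mono_neutral_right) (auto simp: q_star_def)
  also have "\<dots> = f {} * q_star n v x {} + (\<Sum>S\<in>?I. f S * q_star n v x S)"
    by (subst sum.insert) auto
  also have "(\<Sum>S\<in>?I. f S * q_star n v x S) = (\<Sum>p=1..n. f {1..p} * q_star n v x {1..p})"
    by (subst sum.reindex) (auto simp: inj_on_def)
  also have "\<dots> = (\<Sum>p=1..n. f {1..p} * nested_weight n v x p)"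
    by (intro sum.cong refl) (simp only: q_star_initial_segment)
  finally show ?thesis .
qed

lemma sum_q_star_eq_1: "(\<Sum>S\<in>Pow {1..n}. q_star n v x S) = 1"
  using sum_q_star[of "\<lambda>_. 1" n v x] by (simp add: q_star_empty)

lemma marginal_q_star_sum:
  assumes v: "\<forall>i\<in>{1..n}. v i > 0"
  shows "marginal n v (q_star n v x) T = of_bool (T = {}) * q_star n v x {}
     + (\<Sum>p=1..n. of_bool (T \<subseteq> {1..p}) * ((x(n + 1 := 0)) p - (x(n + 1 := 0)) (p + 1)))"
proof -
  have "marginal n v (q_star n v x) T =
      (\<Sum>S\<in>Pow {1..n}. (of_bool (T \<subseteq> S) / total_weight v S) * q_star n v x S)"
    by (simp add: marginal_def)
  also have "\<dots> = of_bool (T \<subseteq> {}) / total_weight v {} * q_star n v x {}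
      + (\<Sum>p=1..n. of_bool (T \<subseteq> {1..p}) / total_weight v {1..p} * nested_weight n v x p)"
    by (rule sum_q_star)
  also have "(\<Sum>p=1..n. of_bool (T \<subseteq> {1..p}) / total_weight v {1..p} * nested_weight n v x p)
      = (\<Sum>p=1..n. of_bool (T \<subseteq> {1..p}) * ((x(n + 1 := 0)) p - (x(n + 1 := 0)) (p + 1)))"
  proof (rule sum.cong[OF refl])
    fix p assume "p \<in> {1..n}"
    then have "total_weight v {1..p} > 0"
      by (intro total_weight_pos[OF v]) auto
    then show "of_bool (T \<subseteq> {1..p}) / total_weight v {1..p} * nested_weight n v x p
        = of_bool (T \<subseteq> {1..p}) * ((x(n + 1 := 0)) p - (x(n + 1 := 0)) (p + 1))"
      unfolding nested_weight_def total_weight_def by simp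
  qed
  finally show ?thesis by (simp add: total_weight_def)
qed

lemma telescope_decrements:
  fixes x :: "nat \<Rightarrow> real"
  assumes "m \<le> n + 1"
  shows "(\<Sum>p=m..n. (x(n + 1 := 0)) p - (x(n + 1 := 0)) (p + 1)) = (x(n + 1 := 0)) m"
  using sum_Suc_diff[of m n "\<lambda>p. - (x(n + 1 := 0)) p"] assms by simp

text \<open>
  A nested set \<open>{1..p}\<close> contains \<open>T\<close> exactly when \<open>p\<close> reaches the largest element of \<open>T\<close>, so
  the decrements of \<open>x\<close> from there on are summed. The sum collapses because the last decrement
  ends at \<open>0\<close>, the value prescribed for \<open>x\<close> at \<open>n + 1\<close>.
\<close>

lemma marginal_q_star:
  assumes v: "\<forall>i\<in>{1..n}. v i > 0" and T: "T \<subseteq> {1..n}" "T \<noteq> {}"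
  shows "marginal n v (q_star n v x) T = x (Max T)"
proof -
  let ?d = "\<lambda>p. (x(n + 1 := 0)) p - (x(n + 1 := 0)) (p + 1)"
  have fin: "finite T" using T(1) by (rule finite_subset) simp
  have Max: "Max T \<in> {1..n}" using Max_in[OF fin T(2)] T(1) by blast
  have sub: "T \<subseteq> {1..p} \<longleftrightarrow> Max T \<le> p" for p
    using fin T by (auto simp: Max_le_iff)
  have "marginal n v (q_star n v x) T = (\<Sum>p=1..n. of_bool (T \<subseteq> {1..p}) * ?d p)"
    using marginal_q_star_sum[of n v x T] v T(2) by simp
  also have "\<dots> = (\<Sum>p=Max T..n. ?d p)"
    unfolding sub using Max by (intro sum.mono_neutral_cong_right) auto
  also have "\<dots> = (x(n + 1 := 0)) (Max T)"
    using Max by (intro telescope_decrements) auto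
  finally show ?thesis using Max by simp
qed

text \<open>
  The empty set receives what the marginal \<open>x\<^sub>0\<close> of \<open>{}\<close> leaves after the nested sets have used
  up \<open>x\<^sub>1\<close>; that is where the constraint \<open>x\<^sub>1 \<le> x\<^sub>0\<close> enters.
\<close>

lemma q_star_nonneg:
  assumes v: "\<forall>i\<in>{1..n}. v i > 0"
    and sorted: "\<And>i j. 1 \<le> i \<Longrightarrow> i \<le> j \<Longrightarrow> j \<le> n \<Longrightarrow> x i \<ge> x j"
    and x0: "x 0 + (\<Sum>i=1..n. v i * x i) = 1"
    and le_x0: "\<And>i. i \<in> {1..n} \<Longrightarrow> x i \<le> x 0"
    and nonneg: "\<And>i. i \<in> {1..n} \<Longrightarrow> x i \<ge> 0"
  shows "q_star n v x S \<ge> 0"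
proof -
  have nested: "nested_weight n v x p \<ge> 0" if p: "p \<in> {1..n}" for p
  proof -
    have "(x(n + 1 := 0)) (p + 1) \<le> (x(n + 1 := 0)) p"
      using p sorted[of p "p + 1"] nonneg[of p] by auto
    moreover have "total_weight v {1..p} > 0"
      using p by (intro total_weight_pos[OF v]) auto
    ultimately show ?thesis by (simp add: nested_weight_def total_weight_def)
  qed
  have "(\<Sum>i=1..n. v i * marginal n v (q_star n v x) {i}) = (\<Sum>i=1..n. v i * x i)"
    by (intro sum.cong refl) (simp add: marginal_q_star[OF v])
  then have "marginal n v (q_star n v x) {} = x 0"
    using mass_eq_marginals[OF v, of "q_star n v x"] sum_q_star_eq_1[of n v x] x0 by simp
  moreover have "marginal n v (q_star n v x) {} = q_star n v x {} + (x(n + 1 := 0)) 1"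
    using marginal_q_star_sum[of n v x "{}"] v telescope_decrements[of 1 n x] by simp
  ultimately have empty: "q_star n v x {} = x 0 - (x(n + 1 := 0)) 1" by simp
  (* For n = 0 the update at n + 1 hits index 1, so x 1 does not occur in the formula above. *)
  have "q_star n v x {} \<ge> 0"
  proof (cases "n = 0")
    case True
    then show ?thesis by (simp add: q_star_empty)
  next
    case False
    then show ?thesis using empty le_x0[of 1] by simp
  qed
  moreover have "S = {} \<or> (\<exists>p\<in>{1..n}. S = {1..p})" if "q_star n v x S \<noteq> 0"
    using that by (auto simp: q_star_def split: if_splits)
  ultimately show ?thesis using nested q_star_initial_segment by fastforce
qed

text \<open>
  Replacing \<open>y\<^sub>i\<^sub>j\<close> by the marginal of \<open>{i, j}\<close> can only raise the category sums, because the
  weights are positive.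
\<close>

lemma raoc_feasible_q_star:
  assumes v: "\<forall>i\<in>{1..n}. v i > 0"
    and C: "\<And>k. k \<in> {1..K} \<Longrightarrow> C k \<subseteq> {1..n}"
    and sorted: "\<And>i j. 1 \<le> i \<Longrightarrow> i \<le> j \<Longrightarrow> j \<le> n \<Longrightarrow> x i \<ge> x j"
    and feas: "lp_feasible n v K C l (x, y)"
  shows "raoc_feasible n K C l (q_star n v x)"
proof -
  let ?m = "marginal n v (q_star n v x)"
  have y_le: "y i j \<le> x i" "y i j \<le> x j" if "i \<in> {1..n}" "j \<in> {1..n}" for i j
    using feas that by (auto simp: lp_feasible_def)
  have single: "?m {i} = x i" if "i \<in> {1..n}" for i
    using marginal_q_star[of n v "{i}" x] v that by simp
  (* The marginal is x i or x j, whichever index is larger, so both upper bounds on y enter. *)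
  have pair: "y i j \<le> ?m {i, j}" if "i \<in> {1..n}" "j \<in> {1..n}" for i j
    using marginal_q_star[of n v "{i, j}" x] v that y_le[OF that] by (simp add: max_def)
  have "(\<Sum>S\<in>Pow {1..n}. real (card (S \<inter> C k)) * q_star n v x S) \<ge> real_of_int (l k)"
    if k: "k \<in> {1..K}" for k
  proof -
    have "real_of_int (l k) \<le> (\<Sum>i\<in>C k. x i + (\<Sum>j=1..n. v j * y i j))"
      using feas k by (simp add: lp_feasible_def)
    also have "\<dots> \<le> (\<Sum>i\<in>C k. ?m {i} + (\<Sum>j=1..n. v j * ?m {i, j}))"
    proof (rule sum_mono)
      fix i assume "i \<in> C k"
      then have i: "i \<in> {1..n}" using C[OF k] by blast
      have "(\<Sum>j=1..n. v j * y i j) \<le> (\<Sum>j=1..n. v j * ?m {i, j})"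
        using v pair[OF i] by (intro sum_mono mult_left_mono) (auto simp: less_imp_le)
      then show "x i + (\<Sum>j=1..n. v j * y i j) \<le> ?m {i} + (\<Sum>j=1..n. v j * ?m {i, j})"
        by (simp add: single[OF i])
    qed
    also have "\<dots> = (\<Sum>S\<in>Pow {1..n}. real (card (S \<inter> C k)) * q_star n v x S)"
      by (rule category_sum_eq_marginals[OF v C[OF k], symmetric])
    finally show ?thesis .
  qed
  moreover have "q_star n v x S \<ge> 0" for S
    using feas by (intro q_star_nonneg[OF v sorted]) (auto simp: lp_feasible_def)
  ultimately show ?thesis using sum_q_star_eq_1[of n v x] by (simp add: raoc_feasible_def)
qed

lemma raoc_objective_q_star:
  assumes v: "\<forall>i\<in>{1..n}. v i > 0"
  shows "raoc_objective n r v (q_star n v x) = lp_objective n r v (x, y)"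
  unfolding objective_eq_marginals lp_objective_def prod.case
  by (intro sum.cong refl) (simp add: marginal_q_star[OF v])

section \<open>Optimality\<close>

theorem theorem5:
  fixes n K :: nat
    and r v :: "nat \<Rightarrow> real"
    and C :: "nat \<Rightarrow> nat set"
    and l :: "nat \<Rightarrow> int"
    and x :: "nat \<Rightarrow> real"
    and y :: "nat \<Rightarrow> nat \<Rightarrow> real"
  assumes weights_pos: "\<And>i. i \<in> {1..n} \<Longrightarrow> v i > 0"
    and categories: "\<And>k. k \<in> {1..K} \<Longrightarrow> C k \<subseteq> {1..n}"
    and thresholds: "\<And>k. k \<in> {1..K} \<Longrightarrow> 0 \<le> l k \<and> l k \<le> int (card (C k))"
    and optimal: "lp_optimal n r v K C l (x, y)"
    and sorted: "\<And>i j. 1 \<le> i \<Longrightarrow> i \<le> j \<Longrightarrow> j \<le> n \<Longrightarrow> x i \<ge> x j"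
  shows "raoc_optimal n r v K C l (q_star n v x)"
proof -
  have v: "\<forall>i\<in>{1..n}. v i > 0" using weights_pos by blast
  have feas: "lp_feasible n v K C l (x, y)"
    and best: "\<And>z. lp_feasible n v K C l z \<Longrightarrow>
      \<not> lp_objective n r v (x, y) < lp_objective n r v z"
    using optimal unfolding lp_optimal_def is_arg_max_def by blast+
  have "raoc_objective n r v q \<le> raoc_objective n r v (q_star n v x)"
    if "raoc_feasible n K C l q" for q
    using best[OF lp_feasible_marginal_point[OF v categories that]]
    by (simp add: lp_objective_marginal_point raoc_objective_q_star[OF v, where y = y])
  moreover have "raoc_feasible n K C l (q_star n v x)"
    by (rule raoc_feasible_q_star[OF v categories sorted feas])
  ultimately show ?thesis
    by (auto simp: raoc_optimal_def is_arg_max_def not_less)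
qed

end
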